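(* Let $n\ge0$ and $i\in\mathcal{V}$. Let $\mathcal{B}\subset\mathcal{A}$ be a convex invariant set for $\partial_t u+\nabla\cdot f(u)=S(u)$, with associated constant $\tau_0>0$. Assume that $\Delta t$ is small enough so that $1+4\Delta t\,\frac{d_{ii}^{L,n}}{m_i}\ge0$ and $2\Delta t\le\tau_0$. If $U_j^n\in\mathcal{B}$ for all $j\in\mathcal{I}(i)$, then $U_i^{L,n+1}\in\mathcal{B}$.
   Context: Hyperbolic system. $\mathcal{A}\subset\mathbb{R}^m$ is a nonempty admissible set, $f:\mathcal{A}\to\mathbb{R}^{m\times d}$ a flux, $S:\mathcal{A}\to\mathbb{R}^m$ a source. For all $v_L,v_R\in\mathcal{A}$ and every unit vector $n\in\mathbb{R}^d$, the Riemann problem $\partial_t v+\partial_x(f(v)n)=0$, $v(x,0)=v_L$ for $x<0$, $v(x,0)=v_R$ for $x>0$, is assumed to have a unique entropy-satisfying self-similar weak solution $v(n,v_L,v_R,\xi)$, $\xi=x/t$, and a maximum wave speed $\lambda_{\max}(n,v_L,v_R)$ such that this solution equals $v_L$ if $\xi\le-\lambda_{\max}(n,v_L,v_R)$ and $v_R$ if $\xi\ge\lambda_{\max}(n,v_L,v_R)$. The average over the Riemann fan is $\overline{v}(t,n,v_L,v_R):=\int_{-1/2}^{1/2}v(n,v_L,v_R,x/t)\,dx$; recall that if $t\lambda_{\max}(n,v_L,v_R)\le\frac12$ then $\overline{v}(t,n,v_L,v_R)=\frac12(v_L+v_R)-t\,(f(v_R)n-f(v_L)n)$. Invariant set. $\mathcal{B}\subset\mathcal{A}$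 is an invariant set if it is convex, if for all $v_L,v_R\in\mathcal{B}$, all unit vectors $n$ and all $t>0$ with $t\lambda_{\max}(n,v_L,v_R)\le\frac12$ one has $\overline{v}(t,n,v_L,v_R)\in\mathcal{B}$, and if there is $\tau_0>0$ such that $U+\tau S(U)\in\mathcal{B}$ for all $U\in\mathcal{B}$ and all $\tau\in[0,\tau_0]$. Low-order scheme. $\mathcal{V}$ is a finite index set; for each $i\in\mathcal{V}$, $\mathcal{I}(i)\subset\mathcal{V}$ contains $i$, and $j\in\mathcal{I}(i)$ iff $i\in\mathcal{I}(j)$. $m_i>0$; $c_{ij}\in\mathbb{R}^d$ satisfy $c_{ij}=-c_{ji}$ and $\sum_{j\in\mathcal{I}(i)}c_{ij}=0$. $\Delta t>0$ is the time step and $U_i^n\in\mathcal{A}$. With $n_{ij}:=c_{ij}/\|c_{ij}\|_{\ell^2}$, for $j\ne i$, $$d_{ij}^{L,n}:=\max\big(\lambda_{\max}(n_{ij},U_i^n,U_j^n)\|c_{ij}\|_{\ell^2},\ \lambda_{\max}(n_{ji},U_j^n,U_i^n)\|c_{ji}\|_{\ell^2}\big),$$ assumed $>0$ (in particular $c_{ij}\neq0$), and $d_{ii}^{L,n}:=-\sum_{j\in\mathcal{I}(i)\setminus\{i\}}d_{ij}^{L,n}$. The low-order update $U_i^{L,n+1}$ is defined by $$\tfrac{m_i}{\Delta t}(U_i^{L,n+1}-U_i^n)+\sum_{j\in\mathcal{I}(i)}f(U_j^n)c_{ij}-\sum_{j\in\mathcal{I}(i)\setminus\{i\}}d_{ij}^{L,n}(U_j^n-U_i^n)=m_iS(U_i^n).$$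 *)

theory Defs
  imports "HOL-Analysis.Analysis"
begin

section \<open>Weak solutions on the half-plane\<close>

text \<open>Space-time points are pairs (x, t). Fields are only looked at for t > 0, and local
  integrability is understood up to the initial line t = 0.\<close>

definition half_plane :: "(real \<times> real) set" where
  "half_plane = UNIV \<times> {0<..}"

definition locally_integrable :: "(real \<times> real \<Rightarrow> 'a::euclidean_space) \<Rightarrow> bool" where
  "locally_integrable u \<longleftrightarrow> (\<forall>K. compact K \<longrightarrow> set_integrable lborel (K \<inter> half_plane) u)"

text \<open>Continuously differentiable functions with compact support, given together with their
  partial derivatives in x and t. The support may meet the initial line.\<close>

definition test_function ::
  "(real \<times> real \<Rightarrow> real) \<Rightarrow> (real \<times> real \<Rightarrow> real) \<Rightarrow> (real \<times> real \<Rightarrow> real) \<Rightarrow> bool" where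
  "test_function \<phi> \<phi>x \<phi>t \<longleftrightarrow>
     (\<forall>p. (\<phi> has_derivative (\<lambda>h. \<phi>x p * fst h + \<phi>t p * snd h)) (at p)) \<and>
     continuous_on UNIV \<phi>x \<and> continuous_on UNIV \<phi>t \<and>
     compact (closure {p. \<phi> p \<noteq> 0})"

text \<open>The distributional pairing of \<open>-(\<partial>\<^sub>t a + \<partial>\<^sub>x b)\<close>, with initial datum \<open>a0\<close>, against a test
  function.\<close>

definition weak_pairing ::
  "(real \<times> real \<Rightarrow> 'a::euclidean_space) \<Rightarrow> (real \<times> real \<Rightarrow> 'a) \<Rightarrow> (real \<Rightarrow> 'a)
    \<Rightarrow> (real \<times> real \<Rightarrow> real) \<Rightarrow> (real \<times> real \<Rightarrow> real) \<Rightarrow> (real \<times> real \<Rightarrow> real) \<Rightarrow> 'a" where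
  "weak_pairing a b a0 \<phi> \<phi>x \<phi>t =
     (LINT p:half_plane|lborel. \<phi>t p *\<^sub>R a p + \<phi>x p *\<^sub>R b p)
     + (LINT x|lborel. \<phi> (x, 0) *\<^sub>R a0 x)"

definition riemann_data :: "'a \<Rightarrow> 'a \<Rightarrow> real \<Rightarrow> 'a" where
  "riemann_data vL vR x = (if x < 0 then vL else vR)"

definition self_similar :: "(real \<Rightarrow> 'a) \<Rightarrow> real \<times> real \<Rightarrow> 'a" where
  "self_similar w = (\<lambda>(x, t). w (x / t))"

section \<open>The Riemann problem\<close>

text \<open>The flux \<open>f u\<close> is an m by d matrix, so \<open>f u *v n\<close> is the flux in direction \<open>n\<close>.\<close>

definition weak_riemann_solution ::
  "(real^'m \<Rightarrow> real^'d^'m) \<Rightarrow> real^'d \<Rightarrow> real^'m \<Rightarrow> real^'m \<Rightarrow> (real \<Rightarrow> real^'m) \<Rightarrow> bool" where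
  "weak_riemann_solution f n vL vR w \<longleftrightarrow>
     locally_integrable (self_similar w) \<and>
     locally_integrable (self_similar (\<lambda>\<xi>. f (w \<xi>) *v n)) \<and>
     (\<forall>\<phi> \<phi>x \<phi>t. test_function \<phi> \<phi>x \<phi>t \<longrightarrow>
        weak_pairing (self_similar w) (self_similar (\<lambda>\<xi>. f (w \<xi>) *v n))
          (riemann_data vL vR) \<phi> \<phi>x \<phi>t = 0)"

text \<open>Entropy pairs: the entropy is convex (the admissible set itself need not be), and the
  entropy flux satisfies \<open>Dq\<^sub>k = D\<eta> Df\<^sub>k\<close> for each space direction \<open>k\<close>. This is required in the
  interior only: typical entropies are not differentiable on the boundary of the admissible
  set.\<close>

definition entropy_pair ::
  "(real^'m) set \<Rightarrow> (real^'m \<Rightarrow> real^'d^'m) \<Rightarrow> (real^'m \<Rightarrow> real) \<Rightarrow> (real^'m \<Rightarrow> real^'d) \<Rightarrow> bool" where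
  "entropy_pair A f \<eta> q \<longleftrightarrow>
     (\<forall>C. C \<subseteq> A \<longrightarrow> convex C \<longrightarrow> convex_on C \<eta>) \<and>
     (\<forall>u\<in>interior A. \<exists>Df D\<eta> Dq.
        (f has_derivative Df) (at u) \<and> (\<eta> has_derivative D\<eta>) (at u) \<and>
        (q has_derivative Dq) (at u) \<and>
        (\<forall>h k. Dq h $ k = D\<eta> (column k (Df h))))"

definition entropy_inequality ::
  "(real^'m \<Rightarrow> real) \<Rightarrow> (real^'m \<Rightarrow> real^'d) \<Rightarrow> real^'d \<Rightarrow> real^'m \<Rightarrow> real^'m
    \<Rightarrow> (real \<Rightarrow> real^'m) \<Rightarrow> bool" where
  "entropy_inequality \<eta> q n vL vR w \<longleftrightarrow>
     locally_integrable (self_similar (\<lambda>\<xi>. \<eta> (w \<xi>))) \<and>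
     locally_integrable (self_similar (\<lambda>\<xi>. q (w \<xi>) \<bullet> n)) \<and>
     (\<forall>\<phi> \<phi>x \<phi>t. test_function \<phi> \<phi>x \<phi>t \<and> (\<forall>p. 0 \<le> \<phi> p) \<longrightarrow>
        0 \<le> weak_pairing (self_similar (\<lambda>\<xi>. \<eta> (w \<xi>))) (self_similar (\<lambda>\<xi>. q (w \<xi>) \<bullet> n))
              (riemann_data (\<eta> vL) (\<eta> vR)) \<phi> \<phi>x \<phi>t)"

definition entropy_riemann_solution ::
  "(real^'m) set \<Rightarrow> (real^'m \<Rightarrow> real^'d^'m) \<Rightarrow> ((real^'m \<Rightarrow> real) \<times> (real^'m \<Rightarrow> real^'d)) set
    \<Rightarrow> real^'d \<Rightarrow> real^'m \<Rightarrow> real^'m \<Rightarrow> (real \<Rightarrow> real^'m) \<Rightarrow> bool" where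
  "entropy_riemann_solution A f E n vL vR w \<longleftrightarrow>
     (\<forall>\<xi>. w \<xi> \<in> A) \<and>
     weak_riemann_solution f n vL vR w \<and>
     (\<forall>(\<eta>, q)\<in>E. entropy_inequality \<eta> q n vL vR w)"

text \<open>\<open>E\<close> is the family of entropy pairs with respect to which solutions are entropy-satisfying;
  it may be the family of all entropy pairs. Uniqueness is up to null sets, while \<open>v n vL vR\<close> is
  the representative that equals the initial states outside the Riemann fan.\<close>

locale hyperbolic_system =
  fixes A :: "(real^'m) set"
    and f :: "real^'m \<Rightarrow> real^'d^'m"
    and E :: "((real^'m \<Rightarrow> real) \<times> (real^'m \<Rightarrow> real^'d)) set"
    and v :: "real^'d \<Rightarrow> real^'m \<Rightarrow> real^'m \<Rightarrow> real \<Rightarrow> real^'m"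
    and lam :: "real^'d \<Rightarrow> real^'m \<Rightarrow> real^'m \<Rightarrow> real"
  assumes nonempty: "A \<noteq> {}"
    and entropies: "(\<eta>, q) \<in> E \<Longrightarrow> entropy_pair A f \<eta> q"
    and riemann_solution:
      "\<lbrakk>vL \<in> A; vR \<in> A; norm n = 1\<rbrakk> \<Longrightarrow> entropy_riemann_solution A f E n vL vR (v n vL vR)"
    and riemann_unique:
      "\<lbrakk>vL \<in> A; vR \<in> A; norm n = 1; entropy_riemann_solution A f E n vL vR w\<rbrakk>
        \<Longrightarrow> AE \<xi> in lborel. w \<xi> = v n vL vR \<xi>"
    and left_of_fan:
      "\<lbrakk>vL \<in> A; vR \<in> A; norm n = 1; \<xi> \<le> - lam n vL vR\<rbrakk> \<Longrightarrow> v n vL vR \<xi> = vL"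
    and right_of_fan:
      "\<lbrakk>vL \<in> A; vR \<in> A; norm n = 1; lam n vL vR \<le> \<xi>\<rbrakk> \<Longrightarrow> v n vL vR \<xi> = vR"

definition fan_average ::
  "(real^'d \<Rightarrow> real^'m \<Rightarrow> real^'m \<Rightarrow> real \<Rightarrow> real^'m)
    \<Rightarrow> real \<Rightarrow> real^'d \<Rightarrow> real^'m \<Rightarrow> real^'m \<Rightarrow> real^'m" where
  "fan_average v t n vL vR = (LINT x:{-1/2..1/2}|lborel. v n vL vR (x / t))"

section \<open>Invariant sets\<close>

text \<open>The constant \<open>\<tau>0\<close> associated with the source is an explicit argument.\<close>

definition invariant_set ::
  "(real^'m) set \<Rightarrow> (real^'m \<Rightarrow> real^'m) \<Rightarrow> (real^'d \<Rightarrow> real^'m \<Rightarrow> real^'m \<Rightarrow> real \<Rightarrow> real^'m)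
    \<Rightarrow> (real^'d \<Rightarrow> real^'m \<Rightarrow> real^'m \<Rightarrow> real) \<Rightarrow> (real^'m) set \<Rightarrow> real \<Rightarrow> bool" where
  "invariant_set A S v lam B \<tau>0 \<longleftrightarrow>
     B \<subseteq> A \<and> convex B \<and>
     (\<forall>vL\<in>B. \<forall>vR\<in>B. \<forall>n t. norm n = 1 \<and> 0 < t \<and> t * lam n vL vR \<le> 1/2
        \<longrightarrow> fan_average v t n vL vR \<in> B) \<and>
     0 < \<tau>0 \<and> (\<forall>U\<in>B. \<forall>\<tau>\<in>{0..\<tau>0}. U + \<tau> *\<^sub>R S U \<in> B)"

section \<open>The low-order scheme\<close>

locale discretization =
  fixes V :: "'i set"
    and I :: "'i \<Rightarrow> 'i set"
    and m :: "'i \<Rightarrow> real"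
    and c :: "'i \<Rightarrow> 'i \<Rightarrow> real^'d"
  assumes finite_V: "finite V"
    and stencil_subset: "i \<in> V \<Longrightarrow> I i \<subseteq> V"
    and stencil_refl: "i \<in> V \<Longrightarrow> i \<in> I i"
    and stencil_sym: "\<lbrakk>i \<in> V; j \<in> V\<rbrakk> \<Longrightarrow> j \<in> I i \<longleftrightarrow> i \<in> I j"
    and mass_pos: "i \<in> V \<Longrightarrow> 0 < m i"
    and c_skew: "\<lbrakk>i \<in> V; j \<in> I i\<rbrakk> \<Longrightarrow> c i j = - c j i"
    and c_sum: "i \<in> V \<Longrightarrow> (\<Sum>j\<in>I i. c i j) = 0"

definition unit_normal :: "('i \<Rightarrow> 'i \<Rightarrow> real^'d) \<Rightarrow> 'i \<Rightarrow> 'i \<Rightarrow> real^'d" where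
  "unit_normal c i j = c i j /\<^sub>R norm (c i j)"

definition viscosity_off ::
  "(real^'d \<Rightarrow> real^'m \<Rightarrow> real^'m \<Rightarrow> real) \<Rightarrow> ('i \<Rightarrow> 'i \<Rightarrow> real^'d) \<Rightarrow> ('i \<Rightarrow> real^'m)
    \<Rightarrow> 'i \<Rightarrow> 'i \<Rightarrow> real" where
  "viscosity_off lam c U i j =
     max (lam (unit_normal c i j) (U i) (U j) * norm (c i j))
         (lam (unit_normal c j i) (U j) (U i) * norm (c j i))"

definition viscosity ::
  "(real^'d \<Rightarrow> real^'m \<Rightarrow> real^'m \<Rightarrow> real) \<Rightarrow> ('i \<Rightarrow> 'i set) \<Rightarrow> ('i \<Rightarrow> 'i \<Rightarrow> real^'d)
    \<Rightarrow> ('i \<Rightarrow> real^'m) \<Rightarrow> 'i \<Rightarrow> 'i \<Rightarrow> real" where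
  "viscosity lam I c U i j =
     (if j = i then - (\<Sum>k\<in>I i - {i}. viscosity_off lam c U i k) else viscosity_off lam c U i j)"

text \<open>\<open>UL\<close> is the low-order update at node \<open>i\<close> of the state \<open>U\<close> after a time step \<open>dt\<close>.\<close>

definition low_order_update ::
  "(real^'m \<Rightarrow> real^'d^'m) \<Rightarrow> (real^'m \<Rightarrow> real^'m) \<Rightarrow> (real^'d \<Rightarrow> real^'m \<Rightarrow> real^'m \<Rightarrow> real)
    \<Rightarrow> ('i \<Rightarrow> 'i set) \<Rightarrow> ('i \<Rightarrow> real) \<Rightarrow> ('i \<Rightarrow> 'i \<Rightarrow> real^'d)
    \<Rightarrow> real \<Rightarrow> ('i \<Rightarrow> real^'m) \<Rightarrow> 'i \<Rightarrow> real^'m \<Rightarrow> bool" where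
  "low_order_update f S lam I m c dt U i UL \<longleftrightarrow>
     (m i / dt) *\<^sub>R (UL - U i) + (\<Sum>j\<in>I i. f (U j) *v c i j)
       - (\<Sum>j\<in>I i - {i}. viscosity lam I c U i j *\<^sub>R (U j - U i)) = m i *\<^sub>R S (U i)"

end

theory Submission
  imports Defs
begin

text \<open>The update is the midpoint of two states of \<open>B\<close>. Write \<open>J = I i - {i}\<close>, \<open>d j\<close> for the viscosity
  between \<open>i\<close> and \<open>j\<close>, and \<open>U\<close> for the state before the step. Because the \<open>c i j\<close> sum to zero,
  \<open>f (U i) *v c i j\<close> may be subtracted from every flux in the scheme. With
    \<^item> the source state \<open>U i + (2 * dt) *\<^sub>R S (U i)\<close>,
    \<^item> the bar states \<open>(1/2) *\<^sub>R (U i + U j) - (1 / (2 * d j)) *\<^sub>R (f (U j) *v c i j - f (U i) *v c i j)\<close>,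
    \<^item> the weights \<open>r j = 4 * dt * d j / m i\<close>,

  the update is the midpoint of the source state and \<open>U i + (\<Sum>j\<in>J. r j *\<^sub>R (bar j - U i))\<close>.
  The source state lies in \<open>B\<close> by the source condition at \<open>\<tau> = 2 * dt\<close>. The time-step condition says
  that the \<open>r j\<close> add up to at most 1, so the other state is a convex combination of \<open>U i\<close> and the
  bar states (\<open>convex_relaxation\<close>). A bar state is the average over the Riemann fan between \<open>U i\<close>
  and \<open>U j\<close> at the fictitious time \<open>norm (c i j) / (2 * d j)\<close>, and the viscosity is large
  enough to keep the fan inside the averaging window at that time; so the bar state lies in \<open>B\<close>.

  That last identification (\<open>fan_average_conservation\<close>) is conservation in the fan. It is derived
  from the weak formulation with the test function \<open>a x * b t\<close>, where \<open>a\<close> equals 1 on the whole fan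
  as long as \<open>b t \<noteq> 0\<close>. Inside the fan the \<open>x\<close>-derivative of the test function vanishes, so only the
  density enters; outside, density and flux take their constant end values. Fubini and the
  scaling \<open>x = t * \<xi>\<close> then turn the identity in the plane into a multiple, by the integral of \<open>b\<close>
  over positive times, of the conservation law for the profile (\<open>integral_self_similar_fan\<close>).\<close>

section \<open>Test functions\<close>

text \<open>Squaring removes the corner of the positive part; it is the building block of the explicit
  cutoffs.\<close>

lemma max_square_deriv:
  "((\<lambda>z::real. (max 0 z)\<^sup>2) has_real_derivative 2 * max 0 z) (at z)"
proof -
  consider "z < 0" | "z = 0" | "z > 0" by linarith
  then show ?thesis
  proof cases
    case 1
    have "((\<lambda>z::real. 0) has_real_derivative 2 * max 0 z) (at z)"
      using 1 by (simp add: max_def)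
    then show ?thesis
      by (rule has_field_derivative_transform_within_open[where S = "{..<0}"])
        (use 1 in \<open>auto simp: max_def\<close>)
  next
    case 2
    have "((\<lambda>h::real. (max 0 h)\<^sup>2 / h) \<longlongrightarrow> 0) (at 0)"
    proof (rule Lim_null_comparison[where g = "\<lambda>h. \<bar>h\<bar>"])
      show "\<forall>\<^sub>F h in at 0. norm ((max 0 h)\<^sup>2 / h) \<le> \<bar>h::real\<bar>"
        by (intro always_eventually) (auto simp: max_def power2_eq_square)
      show "((\<lambda>h::real. \<bar>h\<bar>) \<longlongrightarrow> 0) (at 0)"
        using tendsto_rabs[OF tendsto_ident_at, of "0::real" UNIV] by simp
    qed
    then show ?thesis using 2 by (simp add: DERIV_def)
  next
    case 3
    have "((\<lambda>z::real. z\<^sup>2) has_real_derivative 2 * max 0 z) (at z)"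
      using 3 by (auto simp: max_def intro!: derivative_eq_intros)
    then show ?thesis
      by (rule has_field_derivative_transform_within_open[where S = "{0<..}"])
        (use 3 in \<open>auto simp: max_def\<close>)
  qed
qed

text \<open>The witness is \<open>(max 0 q)\<^sup>2\<close>, where \<open>q\<close> is 1 on the plateau and loses the square of the distance
  to it, so that it is nonpositive from distance 1 on.\<close>

lemma smooth_plateau:
  fixes L :: real
  assumes "0 \<le> L"
  obtains a a' :: "real \<Rightarrow> real" where
    "\<And>x. (a has_real_derivative a' x) (at x)" "continuous_on UNIV a'"
    "\<And>x. 0 \<le> a x"
    "\<And>x. \<bar>x\<bar> \<le> L \<Longrightarrow> a x = 1" "\<And>x. \<bar>x\<bar> \<le> L \<Longrightarrow> a' x = 0"
    "\<And>x. L + 1 \<le> \<bar>x\<bar> \<Longrightarrow> a x = 0" "\<And>x. L + 1 \<le> \<bar>x\<bar> \<Longrightarrow> a' x = 0"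
proof -
  define q where "q x = 1 - (max 0 (x - L))\<^sup>2 - (max 0 (- x - L))\<^sup>2" for x :: real
  define q' where "q' x = - 2 * max 0 (x - L) + 2 * max 0 (- x - L)" for x :: real
  have q_deriv: "(q has_real_derivative q' x) (at x)" for x
    unfolding q_def q'_def
    by (rule derivative_eq_intros DERIV_chain2[OF max_square_deriv] refl)+ simp
  have q_outside: "q x \<le> 0" if "L + 1 \<le> \<bar>x\<bar>" for x
  proof -
    have "1 \<le> (max 0 (x - L))\<^sup>2 \<or> 1 \<le> (max 0 (- x - L))\<^sup>2"
      using that by (auto simp: abs_if max_def one_le_power split: if_splits)
    then show ?thesis
      using zero_le_power2[of "max 0 (x - L)"] zero_le_power2[of "max 0 (- x - L)"]
      unfolding q_def by linarith
  qed
  show ?thesis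
  proof (rule that[of "\<lambda>x. (max 0 (q x))\<^sup>2" "\<lambda>x. 2 * max 0 (q x) * q' x"])
    show "((\<lambda>x. (max 0 (q x))\<^sup>2) has_real_derivative 2 * max 0 (q x) * q' x) (at x)" for x
      by (rule DERIV_chain2[OF max_square_deriv q_deriv])
    show "continuous_on UNIV (\<lambda>x. 2 * max 0 (q x) * q' x)"
      unfolding q_def q'_def by (intro continuous_intros)
    show "0 \<le> (max 0 (q x))\<^sup>2" for x by simp
    show "(max 0 (q x))\<^sup>2 = 1" "2 * max 0 (q x) * q' x = 0" if "\<bar>x\<bar> \<le> L" for x
    proof -
      have "max 0 (x - L) = 0" "max 0 (- x - L) = 0" using that by auto
      then have "q x = 1" "q' x = 0" unfolding q_def q'_def by simp_all
      then show "(max 0 (q x))\<^sup>2 = 1" "2 * max 0 (q x) * q' x = 0" by simp_all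
    qed
    show "(max 0 (q x))\<^sup>2 = 0" "2 * max 0 (q x) * q' x = 0" if "L + 1 \<le> \<bar>x\<bar>" for x
      using max_absorb1[OF q_outside[OF that]] by simp_all
  qed
qed

lemma test_function_product:
  fixes a a' b b' :: "real \<Rightarrow> real"
  assumes a: "\<And>x. (a has_real_derivative a' x) (at x)" "continuous_on UNIV a'"
    and b: "\<And>t. (b has_real_derivative b' t) (at t)" "continuous_on UNIV b'"
    and a_support: "\<And>x. R \<le> \<bar>x\<bar> \<Longrightarrow> a x = 0"
    and b_support: "\<And>t. T \<le> \<bar>t\<bar> \<Longrightarrow> b t = 0"
  shows "test_function (\<lambda>p. a (fst p) * b (snd p)) (\<lambda>p. a' (fst p) * b (snd p))
    (\<lambda>p. a (fst p) * b' (snd p))"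
  unfolding test_function_def
proof (intro conjI allI)
  fix p :: "real \<times> real"
  have "((\<lambda>p. a (fst p)) has_derivative (\<lambda>h. a' (fst p) * fst h)) (at p)"
    using has_derivative_compose[OF has_derivative_fst[OF has_derivative_ident]
        a(1)[of "fst p", unfolded has_field_derivative_def]] by (simp add: mult_ac)
  moreover have "((\<lambda>p. b (snd p)) has_derivative (\<lambda>h. b' (snd p) * snd h)) (at p)"
    using has_derivative_compose[OF has_derivative_snd[OF has_derivative_ident]
        b(1)[of "snd p", unfolded has_field_derivative_def]] by (simp add: mult_ac)
  ultimately have "((\<lambda>p. a (fst p) * b (snd p)) has_derivative
     (\<lambda>h. a (fst p) * (b' (snd p) * snd h) + a' (fst p) * fst h * b (snd p))) (at p)"
    by (rule has_derivative_mult)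
  then show "((\<lambda>p. a (fst p) * b (snd p)) has_derivative
     (\<lambda>h. a' (fst p) * b (snd p) * fst h + a (fst p) * b' (snd p) * snd h)) (at p)"
    by (simp add: ac_simps)
next
  have cont: "continuous_on UNIV a" "continuous_on UNIV b"
    using a(1) b(1) by (auto intro!: DERIV_continuous_on simp: has_field_derivative_at_within)
  show "continuous_on UNIV (\<lambda>p::real\<times>real. a' (fst p) * b (snd p))"
    "continuous_on UNIV (\<lambda>p::real\<times>real. a (fst p) * b' (snd p))"
    by (intro continuous_intros continuous_on_compose2[OF cont(1)] continuous_on_compose2[OF cont(2)]
      continuous_on_compose2[OF a(2)] continuous_on_compose2[OF b(2)]; simp)+
  have "{p. a (fst p) * b (snd p) \<noteq> 0} \<subseteq> {- R..R} \<times> {- T..T}"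
  proof
    fix p assume "p \<in> {p. a (fst p) * b (snd p) \<noteq> 0}"
    then have "\<not> R \<le> \<bar>fst p\<bar>" "\<not> T \<le> \<bar>snd p\<bar>" using a_support b_support by auto
    then show "p \<in> {- R..R} \<times> {- T..T}" by (auto simp: mem_Times_iff)
  qed
  moreover have "bounded ({- R..R} \<times> {- T..T})"
    by (intro bounded_Times bounded_closed_interval)
  ultimately show "compact (closure {p. a (fst p) * b (snd p) \<noteq> 0})"
    using bounded_subset compact_closure by blast
qed

section \<open>Integration tools\<close>

text \<open>Fubini for integrands whose horizontal slices all integrate to multiples of one vector. Time
  \<open>t = 0\<close> is exempt because \<open>x / t\<close> degenerates there.\<close>

lemma integral_plane_rank_one:
  fixes H :: "real \<times> real \<Rightarrow> 'a::euclidean_space"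
  assumes H: "integrable lborel H"
    and slice: "\<And>t. t \<noteq> 0 \<Longrightarrow> (LINT x|lborel. H (x, t)) = \<gamma> t *\<^sub>R y"
    and \<gamma>: "integrable lborel \<gamma>"
  shows "(LINT p|lborel. H p) = (LINT t|lborel. \<gamma> t) *\<^sub>R y"
proof -
  have int: "integrable (lborel \<Otimes>\<^sub>M lborel) (case_prod (\<lambda>x t. H (x, t)))"
    using H by (simp add: lborel_prod case_prod_eta)
  have "(LINT p|lborel. H p) = (LINT t|lborel. LINT x|lborel. H (x, t))"
    using lborel_pair.integral_snd[OF int] by (simp add: lborel_prod case_prod_eta)
  also have "\<dots> = (LINT t|lborel. \<gamma> t *\<^sub>R y)"
  proof (rule integral_cong_AE)
    show "(\<lambda>t. LINT x|lborel. H (x, t)) \<in> borel_measurable lborel"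
      using lborel_pair.integrable_snd[OF int] by simp
    show "(\<lambda>t. \<gamma> t *\<^sub>R y) \<in> borel_measurable lborel"
      using \<gamma> by simp
    show "AE t in lborel. (LINT x|lborel. H (x, t)) = \<gamma> t *\<^sub>R y"
      using AE_lborel_singleton[of 0] slice by (auto elim!: eventually_mono)
  qed
  also have "\<dots> = (LINT t|lborel. \<gamma> t) *\<^sub>R y"
    using \<gamma> by simp
  finally show ?thesis .
qed

lemma integrable_bounded_compact_support:
  fixes h :: "'b::euclidean_space \<Rightarrow> 'a::euclidean_space"
  assumes "h \<in> borel_measurable borel" "compact K" 
    "\<And>p. norm (h p) \<le> C" "\<And>p. p \<notin> K \<Longrightarrow> h p = 0"
  shows "integrable lborel h"
proof -
  have "integrable lborel (\<lambda>p. indicator K p *\<^sub>R h p)"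
    by (rule integrableI_bounded_set_indicator[where B = C])
      (use assms emeasure_compact_finite in \<open>auto intro: borel_compact\<close>)
  moreover have "(\<lambda>p. indicator K p *\<^sub>R h p) = h"
    using assms(4) by (auto simp: indicator_def fun_eq_iff)
  ultimately show ?thesis by simp
qed

lemma integrable_bounded_scaleR:
  fixes h :: "'b \<Rightarrow> 'a::euclidean_space"
  assumes "integrable M h" "k \<in> borel_measurable M" "\<And>p. \<bar>k p\<bar> \<le> C"
  shows "integrable M (\<lambda>p. k p *\<^sub>R h p)"
proof (rule Bochner_Integration.integrable_bound[where f = "\<lambda>p. C *\<^sub>R h p"])
  have "0 \<le> C" using assms(3)[of undefined] by linarith
  then show "AE p in M. norm (k p *\<^sub>R h p) \<le> norm (C *\<^sub>R h p)"
    by (intro always_eventually allI) (simp add: mult_right_mono assms(3))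
qed (use assms in auto)

text \<open>Substituting \<open>x = t \<xi>\<close> on each slice produces the Jacobian \<open>t\<close>, hence the first moment of \<open>\<beta>\<close>.\<close>

lemma integral_self_similar:
  fixes F :: "real \<Rightarrow> 'a::euclidean_space"
  assumes int: "integrable lborel (\<lambda>p. \<beta> (snd p) *\<^sub>R F (fst p / snd p))"
    and past: "\<And>t. t \<le> 0 \<Longrightarrow> \<beta> t = 0"
    and moment: "integrable lborel (\<lambda>t. t * \<beta> t)"
  shows "(LINT p|lborel. \<beta> (snd p) *\<^sub>R F (fst p / snd p))
    = (LINT t|lborel. t * \<beta> t) *\<^sub>R (LINT \<xi>|lborel. F \<xi>)"
proof (rule integral_plane_rank_one[OF int _ moment])
  fix t :: real assume "t \<noteq> 0"
  show "(LINT x|lborel. \<beta> (snd (x, t)) *\<^sub>R F (fst (x, t) / snd (x, t)))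
    = (t * \<beta> t) *\<^sub>R (LINT \<xi>|lborel. F \<xi>)"
  proof (cases "0 < t")
    case True
    then show ?thesis
      using lborel_integral_real_affine[of "1 / t" F 0] by (simp add: field_simps)
  qed (use past in simp)
qed

lemma integral_Ioc_derivative:
  fixes F h :: "real \<Rightarrow> real"
  assumes "a \<le> b" "\<And>x. (F has_real_derivative h x) (at x)" "continuous_on UNIV h"
  shows "(LINT x|lborel. indicator {a<..b} x * h x) = F b - F a"
proof -
  have "(LBINT x=a..b. h x) = F b - F a"
    using assms by (intro interval_integral_FTC_finite)
      (auto intro: continuous_on_subset has_field_derivative_at_within
        simp flip: has_real_derivative_iff_has_vector_derivative)
  then show ?thesis
    using assms(1) by (simp add: interval_integral_Ioc set_lebesgue_integral_def)
qed

lemma compact_support_bounded: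
  fixes h :: "real \<Rightarrow> real"
  assumes cont: "continuous_on UNIV h" and support: "\<And>x. R \<le> \<bar>x\<bar> \<Longrightarrow> h x = 0"
  obtains C where "0 \<le> C" "\<And>x. \<bar>h x\<bar> \<le> C"
proof -
  have "bounded (h ` {- \<bar>R\<bar>..\<bar>R\<bar>})"
    using cont by (intro compact_imp_bounded compact_continuous_image)
      (auto intro: continuous_on_subset)
  then obtain C where C: "\<And>x. x \<in> {- \<bar>R\<bar>..\<bar>R\<bar>} \<Longrightarrow> \<bar>h x\<bar> \<le> C"
    unfolding bounded_iff by (metis imageI real_norm_def)
  have "\<bar>h x\<bar> \<le> max C 0" for x
  proof (cases "x \<in> {- \<bar>R\<bar>..\<bar>R\<bar>}")
    case True
    then show ?thesis using C by fastforce
  next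
    case False
    then show ?thesis using support[of x] by force
  qed
  then show ?thesis using that[of "max C 0"] by auto
qed

section \<open>Conservation in the Riemann fan\<close>

text \<open>The Rankine--Hugoniot balance for a whole fan. Formally it follows by integrating
  \<open>- \<xi> w' + g' = 0\<close> by parts over \<open>{-L..L}\<close>; here \<open>w\<close> solves the equation only weakly, so the
  computation is moved to the test function \<open>a x * b t\<close>, with \<open>a = 1\<close> on \<open>{-L..L}\<close> and \<open>b\<close> supported
  in \<open>{-1..1}\<close>. For \<open>0 < t \<le> 1\<close> the fan \<open>\<bar>x\<bar> \<le> L t\<close> stays on the plateau of \<open>a\<close>. Comparing
  \<open>w\<close> with the unresolved jump \<open>w0\<close> splits the pairing into a fan part, where only \<open>b'\<close> and the
  variable \<open>x / t\<close> occur, and products of a function of \<open>x\<close> with a function of \<open>t\<close>.\<close>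

lemma integral_self_similar_fan:
  fixes w g :: "real \<Rightarrow> 'a::euclidean_space"
  assumes L: "0 < L"
    and w_int: "locally_integrable (self_similar w)"
    and weak: "\<And>\<phi> \<phi>x \<phi>t. test_function \<phi> \<phi>x \<phi>t \<Longrightarrow>
      weak_pairing (self_similar w) (self_similar g) (riemann_data vL vR) \<phi> \<phi>x \<phi>t = 0"
    and w_left: "\<And>\<xi>. \<xi> \<le> - L \<Longrightarrow> w \<xi> = vL" and w_right: "\<And>\<xi>. L \<le> \<xi> \<Longrightarrow> w \<xi> = vR"
    and g_left: "\<And>\<xi>. \<xi> \<le> - L \<Longrightarrow> g \<xi> = gL" and g_right: "\<And>\<xi>. L \<le> \<xi> \<Longrightarrow> g \<xi> = gR"
  shows "(LINT \<xi>:{- L..L}|lborel. w \<xi>) = L *\<^sub>R (vL + vR) - (gR - gL)"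
proof -
  obtain a a' where a: "\<And>x. (a has_real_derivative a' x) (at x)" "continuous_on UNIV a'"
    "\<And>x. \<bar>x\<bar> \<le> L \<Longrightarrow> a x = 1" "\<And>x. \<bar>x\<bar> \<le> L \<Longrightarrow> a' x = 0"
    "\<And>x. L + 1 \<le> \<bar>x\<bar> \<Longrightarrow> a x = 0" "\<And>x. L + 1 \<le> \<bar>x\<bar> \<Longrightarrow> a' x = 0"
    using smooth_plateau[of L] L by (metis less_imp_le)
  obtain b b' where b: "\<And>t. (b has_real_derivative b' t) (at t)" "continuous_on UNIV b'"
    "\<And>t. 0 \<le> b t" "b 0 = 1"
    "\<And>t. 1 \<le> \<bar>t\<bar> \<Longrightarrow> b t = 0" "\<And>t. 1 \<le> \<bar>t\<bar> \<Longrightarrow> b' t = 0"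
    using smooth_plateau[of 0] by (metis abs_zero add_0 order_refl)
  have cont: "continuous_on UNIV a" "continuous_on UNIV b"
    using a(1) b(1) by (auto intro!: DERIV_continuous_on simp: has_field_derivative_at_within)
  note cont = cont a(2) b(2)
  note [measurable] = cont[THEN borel_measurable_continuous_onI]
  have [measurable]: "fst \<in> borel_measurable (borel :: (real \<times> real) measure)"
    "snd \<in> borel_measurable (borel :: (real \<times> real) measure)"
    by (auto intro!: borel_measurable_continuous_onI continuous_intros)
  obtain Ca where Ca: "0 \<le> Ca" "\<And>x. \<bar>a x\<bar> \<le> Ca"
    using compact_support_bounded[OF cont(1) a(5)] by blast
  obtain Ca' where Ca': "0 \<le> Ca'" "\<And>x. \<bar>a' x\<bar> \<le> Ca'"
    using compact_support_bounded[OF cont(3) a(6)] by blast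
  obtain Cb where Cb: "0 \<le> Cb" "\<And>x. \<bar>b x\<bar> \<le> Cb"
    using compact_support_bounded[OF cont(2) b(5)] by blast
  obtain Cb' where Cb': "0 \<le> Cb'" "\<And>x. \<bar>b' x\<bar> \<le> Cb'"
    using compact_support_bounded[OF cont(4) b(6)] by blast
  define w0 where "w0 = riemann_data vL vR"
  define g0 where "g0 = riemann_data gL gR"
  \<comment> \<open>\<open>W\<close> and \<open>W0\<close> are cut off to the fan, so that \<open>W - W0 = w - w0\<close> everywhere, while each
    of them can be integrated separately.\<close>
  define W where "W \<xi> = indicator {- L..L} \<xi> *\<^sub>R w \<xi>" for \<xi>
  define W0 where "W0 \<xi> = indicator {- L..L} \<xi> *\<^sub>R w0 \<xi>" for \<xi>
  \<comment> \<open>The interval is open at 0 to match the half-plane exactly, because \<open>b 0 = 1\<close>.\<close>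
  define \<beta> where "\<beta> t = indicator {0<..1} t * b t" for t
  define \<beta>' where "\<beta>' t = indicator {0<..1} t * b' t" for t
  have [measurable]: "w0 \<in> borel_measurable borel" "g0 \<in> borel_measurable borel"
    unfolding w0_def g0_def riemann_data_def by measurable
  have [measurable]: "W0 \<in> borel_measurable borel" "\<beta> \<in> borel_measurable borel"
    "\<beta>' \<in> borel_measurable borel"
    unfolding W0_def \<beta>_def \<beta>'_def by measurable
  define v1 where "v1 = norm vL + norm vR"
  define g1 where "g1 = norm gL + norm gR"
  have w0_bound: "norm (w0 x) \<le> v1" and g0_bound: "norm (g0 x) \<le> g1" for x
    by (auto simp: w0_def g0_def riemann_data_def v1_def g1_def)
  have W0_bound: "norm (W0 x) \<le> v1" for x
    using w0_bound[of x] by (auto simp: W0_def indicator_def v1_def)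
  have \<beta>_bound: "\<bar>\<beta> t\<bar> \<le> Cb" and \<beta>'_bound: "\<bar>\<beta>' t\<bar> \<le> Cb'" for t
    using Cb(1) Cb(2)[of t] Cb'(1) Cb'(2)[of t] by (auto simp: \<beta>_def \<beta>'_def indicator_def)
  define K where "K = {- (L + 1)..L + 1} \<times> {0..1::real}"
  have K: "compact K" unfolding K_def by (intro compact_Times compact_Icc)
  have int_line: "integrable lborel h"
    if "h \<in> borel_measurable borel" "\<And>x. norm (h x) \<le> C" "\<And>x. x \<notin> {-(L+1)..L+1} \<Longrightarrow> h x = 0"
    for h :: "real \<Rightarrow> real" and C
    using that by (intro integrable_bounded_compact_support[where K = "{-(L+1)..L+1}" and C = C]) auto
  have \<beta>_int: "integrable lborel \<beta>" and \<beta>'_int: "integrable lborel \<beta>'"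
    by (rule int_line[where C = Cb] int_line[where C = Cb'],
        use \<beta>_bound \<beta>'_bound L in \<open>auto simp: \<beta>_def \<beta>'_def\<close>)+
  have t\<beta>'_int: "integrable lborel (\<lambda>t. t * \<beta>' t)"
  proof (rule int_line[where C = Cb'])
    show "norm (t * \<beta>' t) \<le> Cb'" for t
    proof (cases "t \<in> {0<..1}")
      case True
      then have "\<bar>t\<bar> * \<bar>\<beta>' t\<bar> \<le> 1 * Cb'" by (intro mult_mono \<beta>'_bound) auto
      then show ?thesis by (simp add: abs_mult)
    qed (use Cb'(1) in \<open>simp add: \<beta>'_def\<close>)
  qed (use L in \<open>auto simp: \<beta>'_def\<close>)
  have past: "\<beta>' t = 0" if "t \<le> 0" for t using that by (simp add: \<beta>'_def)

  define B where "B = (LINT t|lborel. \<beta> t)"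
  have B_pos: "B \<noteq> 0"
  proof
    assume "B = 0"
    then have "(LBINT t=0..1. b t) = 0"
      by (simp add: B_def \<beta>_def interval_integral_Ioc set_lebesgue_integral_def zero_ereal_def one_ereal_def)
    moreover have "(LBINT t=ereal 0..ereal 1. b t) = integral {0..1} b"
      by (intro interval_integral_eq_integral borel_integrable_atLeastAtMost')
        (auto intro: continuous_on_subset[OF cont(2)])
    ultimately have "integral {0..1} b = 0" by (simp add: zero_ereal_def one_ereal_def)
    then have "b 0 = 0"
      using integral_eq_0_iff[of 0 1 b] b(3) continuous_on_subset[OF cont(2)] by auto
    then show False using b(4) by simp
  qed
  have \<beta>'_total: "(LINT t|lborel. \<beta>' t) = - 1"
    using integral_Ioc_derivative[OF _ b(1,2), of 0 1] b(4,5) by (simp add: \<beta>'_def)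
  \<comment> \<open>Integration by parts: \<open>t * b t\<close> vanishes at both ends of the unit interval.\<close>
  have moment: "(LINT t|lborel. t * \<beta>' t) = - B"
  proof -
    have "(LINT t|lborel. indicator {0<..1} t * (t * b' t + b t)) = 1 * b 1 - 0 * b 0"
      by (rule integral_Ioc_derivative[where F = "\<lambda>t. t * b t"])
        (auto intro!: derivative_eq_intros b(1) continuous_intros cont)
    moreover have "indicator {0<..1} t * (t * b' t + b t) = t * \<beta>' t + \<beta> t" for t
      by (simp add: \<beta>_def \<beta>'_def algebra_simps)
    ultimately show ?thesis
      using \<beta>_int t\<beta>'_int b(5)[of 1] by (simp add: B_def)
  qed
  have flux_jump: "(LINT x|lborel. a' x *\<^sub>R g0 x) = gL - gR"
  proof -
    have "a' x *\<^sub>R g0 x = (indicator {-(L+1)<..0} x * a' x) *\<^sub>R gL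
        + (indicator {0<..L+1} x * a' x) *\<^sub>R gR" for x
    proof (cases "L < \<bar>x\<bar> \<and> \<bar>x\<bar> < L + 1")
      case True
      then show ?thesis using L
        by (cases "x < 0") (auto simp: g0_def riemann_data_def indicator_def)
    next
      case False
      then have "a' x = 0" using a(4)[of x] a(6)[of x] by linarith
      then show ?thesis by simp
    qed
    moreover have "integrable lborel (\<lambda>x. indicator {-(L+1)<..0} x * a' x)"
       "integrable lborel (\<lambda>x. indicator {0<..L+1} x * a' x)"
      by (rule int_line[where C=Ca']; use Ca' L in \<open>auto simp: indicator_def\<close>)+
    ultimately show ?thesis
      using integral_Ioc_derivative[OF _ a(1,2), of "-(L+1)" 0] integral_Ioc_derivative[OF _ a(1,2), of 0 "L+1"]
        a(3)[of 0] a(5)[of "-(L+1)"] a(5)[of "L+1"] L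
      by simp
  qed
  have W0_total: "(LINT \<xi>|lborel. W0 \<xi>) = L *\<^sub>R (vL + vR)"
  proof -
    have "W0 \<xi> = indicator {-L..<0} \<xi> *\<^sub>R vL + indicator {0..L} \<xi> *\<^sub>R vR" for \<xi>
      using L by (auto simp: W0_def w0_def riemann_data_def indicator_def)
    then show ?thesis
      using L by (simp add: scaleR_right_distrib)
  qed

  have in_K: "p \<in> K \<inter> half_plane"
    if "snd p \<in> {0<..1}" "fst p / snd p \<in> {- L..L}" for p :: "real \<times> real"
  proof -
    have "\<bar>fst p\<bar> \<le> L * snd p" using that by (auto simp: field_simps)
    also have "\<dots> \<le> L" using that L by simp
    finally show ?thesis using that by (auto simp: K_def half_plane_def mem_Times_iff)
  qed
  \<comment> \<open>Unlike the other three terms, this one is not known to be bounded; its integrability comes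
    from the local integrability of the weak solution.\<close>
  have int1: "integrable lborel (\<lambda>p. \<beta>' (snd p) *\<^sub>R W (fst p / snd p))"
  proof -
    have "integrable lborel (\<lambda>p. indicator (K \<inter> half_plane) p *\<^sub>R self_similar w p)"
      using w_int K unfolding locally_integrable_def set_integrable_def by blast
    then have "integrable lborel (\<lambda>p. (\<beta>' (snd p) * indicator {- L..L} (fst p / snd p)) *\<^sub>R
        (indicator (K \<inter> half_plane) p *\<^sub>R self_similar w p))"
    proof (rule integrable_bounded_scaleR[where C = Cb'])
      show "\<bar>\<beta>' (snd p) * indicator {- L..L} (fst p / snd p)\<bar> \<le> Cb'" for p :: "real \<times> real"
        using \<beta>'_bound[of "snd p"] Cb'(1) by (auto simp: indicator_def)
    qed measurable
    moreover have "(\<beta>' (snd p) * indicator {- L..L} (fst p / snd p)) *\<^sub>R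
        (indicator (K \<inter> half_plane) p *\<^sub>R self_similar w p) = \<beta>' (snd p) *\<^sub>R W (fst p / snd p)" for p
    proof (cases "snd p \<in> {0<..1} \<and> fst p / snd p \<in> {- L..L}")
      case True
      then have "p \<in> K \<inter> half_plane" using in_K by blast
      then show ?thesis by (simp add: W_def self_similar_def split_beta)
    qed (auto simp: \<beta>'_def W_def indicator_def)
    ultimately show ?thesis by simp
  qed
  have int2: "integrable lborel (\<lambda>p. \<beta>' (snd p) *\<^sub>R W0 (fst p / snd p))"
  proof (rule integrable_bounded_compact_support[OF _ K])
    show "norm (\<beta>' (snd p) *\<^sub>R W0 (fst p / snd p)) \<le> Cb' * v1" for p :: "real \<times> real"
      unfolding norm_scaleR using Cb'(1) by (intro mult_mono \<beta>'_bound W0_bound) auto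
    show "\<beta>' (snd p) *\<^sub>R W0 (fst p / snd p) = 0" if "p \<notin> K" for p
    proof (rule ccontr)
      assume "\<beta>' (snd p) *\<^sub>R W0 (fst p / snd p) \<noteq> 0"
      then have "snd p \<in> {0<..1}" "fst p / snd p \<in> {- L..L}"
        by (auto simp: \<beta>'_def W0_def indicator_def split: if_splits)
      then show False using in_K that by blast
    qed
  qed measurable
  have int3: "integrable lborel (\<lambda>p. \<beta>' (snd p) *\<^sub>R (a (fst p) *\<^sub>R w0 (fst p)))"
  proof (rule integrable_bounded_compact_support[OF _ K])
    show "norm (\<beta>' (snd p) *\<^sub>R (a (fst p) *\<^sub>R w0 (fst p))) \<le> Cb' * (Ca * v1)" for p :: "real \<times> real"
      unfolding norm_scaleR using Cb'(1) Ca(1) by (intro mult_mono \<beta>'_bound w0_bound Ca) auto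
    show "\<beta>' (snd p) *\<^sub>R (a (fst p) *\<^sub>R w0 (fst p)) = 0" if "p \<notin> K" for p
      using that a(5)[of "fst p"] by (auto simp: K_def mem_Times_iff \<beta>'_def indicator_def abs_if)
  qed measurable
  have int4: "integrable lborel (\<lambda>p. \<beta> (snd p) *\<^sub>R (a' (fst p) *\<^sub>R g0 (fst p)))"
  proof (rule integrable_bounded_compact_support[OF _ K])
    show "norm (\<beta> (snd p) *\<^sub>R (a' (fst p) *\<^sub>R g0 (fst p))) \<le> Cb * (Ca' * g1)" for p :: "real \<times> real"
      unfolding norm_scaleR using Cb(1) Ca'(1) by (intro mult_mono \<beta>_bound g0_bound Ca') auto
    show "\<beta> (snd p) *\<^sub>R (a' (fst p) *\<^sub>R g0 (fst p)) = 0" if "p \<notin> K" for p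
      using that a(6)[of "fst p"] by (auto simp: K_def mem_Times_iff \<beta>_def indicator_def abs_if)
  qed measurable

  \<comment> \<open>The flux keeps only its end states: \<open>a'\<close> vanishes on \<open>{-L..L}\<close>, which contains the fan for
    all times up to 1.\<close>
  have split: "indicator half_plane p *\<^sub>R ((a (fst p) * b' (snd p)) *\<^sub>R self_similar w p
        + (a' (fst p) * b (snd p)) *\<^sub>R self_similar g p)
      = \<beta>' (snd p) *\<^sub>R W (fst p / snd p) - \<beta>' (snd p) *\<^sub>R W0 (fst p / snd p)
        + \<beta>' (snd p) *\<^sub>R (a (fst p) *\<^sub>R w0 (fst p)) + \<beta> (snd p) *\<^sub>R (a' (fst p) *\<^sub>R g0 (fst p))" for p
  proof -
    obtain x t where p: "p = (x, t)" by (cases p)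
    consider "t \<le> 0" | "1 < t" | "0 < t" "t \<le> 1" by linarith
    then show ?thesis
    proof cases
      case 1
      then show ?thesis by (simp add: p half_plane_def \<beta>_def \<beta>'_def)
    next
      case 2
      then show ?thesis using b(5,6)[of t] by (simp add: p half_plane_def \<beta>_def \<beta>'_def)
    next
      case 3
      then have t: "indicator half_plane p = (1::real)" "\<beta> t = b t" "\<beta>' t = b' t"
        by (auto simp: p half_plane_def \<beta>_def \<beta>'_def)
      have Lt: "L * t \<le> L" "0 < L * t" using 3 L by simp_all
      have w_part: "a x *\<^sub>R w (x / t) = W (x / t) - W0 (x / t) + a x *\<^sub>R w0 x"
      proof (cases "\<bar>x\<bar> \<le> L * t")
        case True
        then have "x / t \<in> {- L..L}" using 3 by (auto simp: field_simps)
        moreover have "a x = 1" using a(3)[of x] True Lt by linarith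
        moreover have "w0 (x / t) = w0 x"
          using 3 by (simp add: w0_def riemann_data_def divide_less_0_iff)
        ultimately show ?thesis by (simp add: W_def W0_def)
      next
        case False
        then have out: "x / t \<notin> {- L..L}" using 3 by (auto simp: field_simps)
        have "w (x / t) = w0 x"
        proof (cases "x < 0")
          case True
          then have "x / t \<le> - L" using False 3 by (simp add: field_simps)
          then show ?thesis using w_left True by (simp add: w0_def riemann_data_def)
        next
          case x: False
          then have "L \<le> x / t" using False 3 by (simp add: field_simps)
          then show ?thesis using w_right x by (simp add: w0_def riemann_data_def)
        qed
        then show ?thesis using out by (simp add: W_def W0_def)
      qed
      have g_part: "a' x *\<^sub>R g (x / t) = a' x *\<^sub>R g0 x"
      proof (cases "\<bar>x\<bar> \<le> L")
        case True
        then show ?thesis using a(4) by simp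
      next
        case False
        show ?thesis
        proof (cases "x < 0")
          case True
          then have "x \<le> - (L * t)" using False Lt by linarith
          then have "x / t \<le> - L" using 3 by (simp add: field_simps)
          then show ?thesis using g_left True by (simp add: g0_def riemann_data_def)
        next
          case x: False
          then have "L * t \<le> x" using False Lt by linarith
          then have "L \<le> x / t" using 3 by (simp add: field_simps)
          then show ?thesis using g_right x by (simp add: g0_def riemann_data_def)
        qed
      qed
      have "(a x * b' t) *\<^sub>R w (x / t) + (a' x * b t) *\<^sub>R g (x / t)
        = b' t *\<^sub>R (a x *\<^sub>R w (x / t)) + b t *\<^sub>R (a' x *\<^sub>R g (x / t))" by (simp add: mult.commute)
      also have "\<dots> = b' t *\<^sub>R W (x / t) - b' t *\<^sub>R W0 (x / t) + b' t *\<^sub>R (a x *\<^sub>R w0 x)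
          + b t *\<^sub>R (a' x *\<^sub>R g0 x)"
        unfolding w_part g_part by (simp only: scaleR_right_distrib scaleR_right_diff_distrib)
      finally show ?thesis using t by (simp add: p self_similar_def)
    qed
  qed

  have slice: "(LINT x|lborel. \<eta> (snd (x, t)) *\<^sub>R (\<alpha> (fst (x, t)) *\<^sub>R z (fst (x, t))))
      = \<eta> t *\<^sub>R (LINT x|lborel. \<alpha> x *\<^sub>R z x)"
    for \<eta> \<alpha> :: "real \<Rightarrow> real" and z :: "real \<Rightarrow> 'a" and t
    by (simp only: fst_conv snd_conv integral_scaleR_right)
  \<comment> \<open>The initial datum cancels against the third term, because \<open>\<beta>'\<close> has total mass -1.\<close>
  have "0 = weak_pairing (self_similar w) (self_similar g) w0
      (\<lambda>p. a (fst p) * b (snd p)) (\<lambda>p. a' (fst p) * b (snd p)) (\<lambda>p. a (fst p) * b' (snd p))"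
    using weak[OF test_function_product[OF a(1,2) b(1,2) a(5) b(5)]] by (simp add: w0_def)
  also have "\<dots> = (LINT p|lborel. \<beta>' (snd p) *\<^sub>R W (fst p / snd p))
      - (LINT p|lborel. \<beta>' (snd p) *\<^sub>R W0 (fst p / snd p))
      + (LINT p|lborel. \<beta>' (snd p) *\<^sub>R (a (fst p) *\<^sub>R w0 (fst p)))
      + (LINT p|lborel. \<beta> (snd p) *\<^sub>R (a' (fst p) *\<^sub>R g0 (fst p)))
      + (LINT x|lborel. a x *\<^sub>R w0 x)"
    unfolding weak_pairing_def set_lebesgue_integral_def split
    using int1 int2 int3 int4 b(4) by simp
  also have "(LINT p|lborel. \<beta>' (snd p) *\<^sub>R W (fst p / snd p)) = (- B) *\<^sub>R (LINT \<xi>|lborel. W \<xi>)"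
    using integral_self_similar[OF int1 past t\<beta>'_int] moment by simp
  also have "(LINT p|lborel. \<beta>' (snd p) *\<^sub>R W0 (fst p / snd p)) = (- B) *\<^sub>R (L *\<^sub>R (vL + vR))"
    using integral_self_similar[OF int2 past t\<beta>'_int] moment W0_total by simp
  also have "(LINT p|lborel. \<beta>' (snd p) *\<^sub>R (a (fst p) *\<^sub>R w0 (fst p))) = - (LINT x|lborel. a x *\<^sub>R w0 x)"
    using integral_plane_rank_one[OF int3 slice \<beta>'_int] \<beta>'_total by simp
  also have "(LINT p|lborel. \<beta> (snd p) *\<^sub>R (a' (fst p) *\<^sub>R g0 (fst p))) = B *\<^sub>R (gL - gR)"
    using integral_plane_rank_one[OF int4 slice \<beta>_int] flux_jump by (simp add: B_def)
  finally have "B *\<^sub>R ((LINT \<xi>|lborel. W \<xi>) - (L *\<^sub>R (vL + vR) - (gR - gL))) = 0"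
    by (simp add: algebra_simps)
  then show ?thesis
    using B_pos by (simp add: W_def set_lebesgue_integral_def)
qed

text \<open>Taking \<open>L = 1 / (2 t)\<close>, rather than the maximal speed, makes the fan window \<open>\<bar>x\<bar> \<le> L t\<close> coincide
  with the averaging window, and keeps \<open>L\<close> positive whatever the sign of \<open>lam\<close>.\<close>

lemma fan_average_conservation:
  assumes system: "hyperbolic_system A f E v lam"
    and states: "vL \<in> A" "vR \<in> A" and n: "norm n = 1"
    and t: "0 < t" "t * lam n vL vR \<le> 1 / 2"
  shows "fan_average v t n vL vR = (1 / 2) *\<^sub>R (vL + vR) - t *\<^sub>R (f vR *v n - f vL *v n)"
proof -
  interpret hyperbolic_system A f E v lam by (rule system)
  define L where "L = 1 / (2 * t)"
  define w where "w = v n vL vR"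
  have L: "0 < L" "lam n vL vR \<le> L" using t by (auto simp: L_def field_simps)
  have sol: "weak_riemann_solution f n vL vR w"
    using riemann_solution[OF states n] by (simp add: entropy_riemann_solution_def w_def)
  have left: "w \<xi> = vL" if "\<xi> \<le> - L" for \<xi>
    using left_of_fan[OF states n] that L by (simp add: w_def)
  have right: "w \<xi> = vR" if "L \<le> \<xi>" for \<xi>
    using right_of_fan[OF states n] that L by (simp add: w_def)
  have total: "(LINT \<xi>:{- L..L}|lborel. w \<xi>) = L *\<^sub>R (vL + vR) - (f vR *v n - f vL *v n)"
    by (rule integral_self_similar_fan[OF L(1), where g = "\<lambda>\<xi>. f (w \<xi>) *v n"])
      (use sol left right in \<open>auto simp: weak_riemann_solution_def\<close>)
  have "fan_average v t n vL vR = (LINT x|lborel. indicator {- L..L} (x / t) *\<^sub>R w (x / t))"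
    using t(1) unfolding fan_average_def set_lebesgue_integral_def w_def
    by (intro Bochner_Integration.integral_cong refl) (auto simp: indicator_def L_def field_simps)
  also have "\<dots> = t *\<^sub>R (LINT \<xi>:{- L..L}|lborel. w \<xi>)"
    using lborel_integral_real_affine[of "1 / t" "\<lambda>\<xi>. indicator {- L..L} \<xi> *\<^sub>R w \<xi>" 0] t(1)
    by (simp add: set_lebesgue_integral_def)
  also have "\<dots> = (1 / 2) *\<^sub>R (vL + vR) - t *\<^sub>R (f vR *v n - f vL *v n)"
    using t(1) unfolding total by (simp add: scaleR_diff_right L_def)
  finally show ?thesis .
qed

section \<open>The low-order update\<close>

text \<open>The sum is a convex combination: the weight left over for \<open>x\<close> is \<open>1 - sum r J\<close>.\<close>

lemma convex_relaxation:
  fixes x :: "'a::real_vector"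
  assumes C: "convex C" and J: "finite J" and x: "x \<in> C"
    and y: "\<And>j. j \<in> J \<Longrightarrow> y j \<in> C" and r: "\<And>j. j \<in> J \<Longrightarrow> 0 \<le> r j" "sum r J \<le> 1"
  shows "x + (\<Sum>j\<in>J. r j *\<^sub>R (y j - x)) \<in> C"
proof (cases "sum r J = 0")
  case True
  then have "r j = 0" if "j \<in> J" for j
    using that J r(1) sum_nonneg_eq_0_iff by blast
  then show ?thesis using x by simp
next
  case False
  define s where "s = sum r J"
  have s: "0 < s" "s \<le> 1" using False r sum_nonneg[of J r] by (auto simp: s_def)
  have "(\<Sum>j\<in>J. (r j / s) *\<^sub>R y j) \<in> C"
    using s r y by (intro convex_sum[OF J C]) (auto simp: s_def simp flip: sum_divide_distrib)
  then have "(1 - s) *\<^sub>R x + s *\<^sub>R (\<Sum>j\<in>J. (r j / s) *\<^sub>R y j) \<in> C"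
    using s by (intro convexD[OF C x]) auto
  moreover have "x + (\<Sum>j\<in>J. r j *\<^sub>R (y j - x)) = (1 - s) *\<^sub>R x + s *\<^sub>R (\<Sum>j\<in>J. (r j / s) *\<^sub>R y j)"
    using s(1) by (simp add: s_def scaleR_sum_right scaleR_diff_right sum_subtractf
        scaleR_left_diff_distrib flip: scaleR_sum_left)
  ultimately show ?thesis by simp
qed

theorem theorem3p6:
  fixes A B :: "(real^'m) set"
    and f :: "real^'m \<Rightarrow> real^'d^'m"
    and S :: "real^'m \<Rightarrow> real^'m"
    and E :: "((real^'m \<Rightarrow> real) \<times> (real^'m \<Rightarrow> real^'d)) set"
    and v :: "real^'d \<Rightarrow> real^'m \<Rightarrow> real^'m \<Rightarrow> real \<Rightarrow> real^'m"
    and lam :: "real^'d \<Rightarrow> real^'m \<Rightarrow> real^'m \<Rightarrow> real"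
    and V :: "'i set"
    and I :: "'i \<Rightarrow> 'i set"
    and m :: "'i \<Rightarrow> real"
    and c :: "'i \<Rightarrow> 'i \<Rightarrow> real^'d"
    and dt \<tau>0 :: real
    and U UL :: "nat \<Rightarrow> 'i \<Rightarrow> real^'m"
    and n :: nat
    and i :: 'i
  assumes system: "hyperbolic_system A f E v lam"
    and mesh: "discretization V I m c"
    and dt_pos: "0 < dt"
    and admissible: "\<And>j. j \<in> V \<Longrightarrow> U n j \<in> A"
    and viscosity_pos: "\<And>j k. \<lbrakk>j \<in> V; k \<in> I j; k \<noteq> j\<rbrakk> \<Longrightarrow> 0 < viscosity lam I c (U n) j k"
    and scheme: "\<And>j. j \<in> V \<Longrightarrow> low_order_update f S lam I m c dt (U n) j (UL (Suc n) j)"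
    and node: "i \<in> V"
    and invariant: "invariant_set A S v lam B \<tau>0"
    and cfl: "0 \<le> 1 + 4 * dt * (viscosity lam I c (U n) i i / m i)"
    and source_cfl: "2 * dt \<le> \<tau>0"
    and stencil_in_B: "\<And>j. j \<in> I i \<Longrightarrow> U n j \<in> B"
  shows "UL (Suc n) i \<in> B"
proof -
  interpret hyperbolic_system A f E v lam by (rule system)
  interpret discretization V I m c by (rule mesh)
  define J where "J = I i - {i}"
  define d where "d j = viscosity lam I c (U n) i j" for j
  define bar where "bar j = (1 / 2) *\<^sub>R (U n i + U n j)
    - (1 / (2 * d j)) *\<^sub>R (f (U n j) *v c i j - f (U n i) *v c i j)" for j
  have mass: "0 < m i" by (rule mass_pos[OF node])
  have J: "finite J"
    using finite_V stencil_subset[OF node] finite_subset by (auto simp: J_def)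
  have I_eq: "I i = insert i J" "i \<notin> J" using stencil_refl[OF node] by (auto simp: J_def)
  have B: "B \<subseteq> A" "convex B"
    and fan: "\<And>vL vR n t. \<lbrakk>vL \<in> B; vR \<in> B; norm n = 1; 0 < t; t * lam n vL vR \<le> 1/2\<rbrakk>
      \<Longrightarrow> fan_average v t n vL vR \<in> B"
    and source: "\<And>W \<tau>. \<lbrakk>W \<in> B; 0 \<le> \<tau>; \<tau> \<le> \<tau>0\<rbrakk> \<Longrightarrow> W + \<tau> *\<^sub>R S W \<in> B"
    using invariant unfolding invariant_set_def by auto
  have Ui: "U n i \<in> B" using stencil_in_B I_eq by blast
  have d_pos: "0 < d j" if "j \<in> J" for j
    using viscosity_pos[OF node] that by (auto simp: d_def J_def)

  \<comment> \<open>The time \<open>norm (c i j) / (2 * d j)\<close> converts the flux along the unit normal into the flux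
    along \<open>c i j\<close>. Positivity of the viscosity rules out \<open>c i j = 0\<close>, for which there is no normal.\<close>
  have bar_in_B: "bar j \<in> B" if j: "j \<in> J" for j
  proof -
    have jI: "j \<in> I i" "j \<noteq> i" using j by (auto simp: J_def)
    have Uj: "U n j \<in> B" using stencil_in_B jI by blast
    have d_off: "d j = viscosity_off lam c (U n) i j" using jI by (simp add: d_def viscosity_def)
    have "c i j \<noteq> 0"
    proof
      assume "c i j = 0"
      moreover from this have "c j i = 0" using c_skew[OF node jI(1)] by simp
      ultimately have "d j = 0" by (simp add: d_off viscosity_off_def)
      then show False using d_pos[OF j] by simp
    qed
    define \<nu> where "\<nu> = unit_normal c i j"
    define t where "t = norm (c i j) / (2 * d j)"
    have \<nu>: "norm \<nu> = 1" "c i j = norm (c i j) *\<^sub>R \<nu>"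
      using \<open>c i j \<noteq> 0\<close> by (simp_all add: \<nu>_def unit_normal_def)
    have t: "0 < t" using \<open>c i j \<noteq> 0\<close> d_pos[OF j] by (simp add: t_def)
    have "lam \<nu> (U n i) (U n j) * norm (c i j) \<le> d j"
      by (simp add: d_off viscosity_off_def \<nu>_def)
    then have cfl_t: "t * lam \<nu> (U n i) (U n j) \<le> 1 / 2"
      using d_pos[OF j] by (simp add: t_def field_simps)
    have "f u *v c i j = norm (c i j) *\<^sub>R (f u *v \<nu>)" for u
      by (subst \<nu>(2)) (simp add: matrix_vector_mult_scaleR)
    then have "bar j = (1 / 2) *\<^sub>R (U n i + U n j) - t *\<^sub>R (f (U n j) *v \<nu> - f (U n i) *v \<nu>)"
      by (simp add: bar_def t_def flip: scaleR_diff_right)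
    also have "\<dots> = fan_average v t \<nu> (U n i) (U n j)"
      using B(1) Ui Uj by (intro fan_average_conservation[OF system _ _ \<nu>(1) t cfl_t, symmetric]) auto
    also have "\<dots> \<in> B" by (rule fan[OF Ui Uj \<nu>(1) t cfl_t])
    finally show ?thesis .
  qed

  define r where "r j = 4 * dt * d j / m i" for j
  have "sum r J \<le> 1"
  proof -
    have "viscosity lam I c (U n) i i = - sum d J"
      by (auto simp: viscosity_def d_def J_def intro!: sum.cong)
    then show ?thesis
      using cfl by (simp add: r_def flip: sum_divide_distrib sum_distrib_left)
  qed
  moreover have "0 \<le> r j" if "j \<in> J" for j
    using d_pos[OF that] mass dt_pos by (simp add: r_def)
  ultimately have relaxed: "U n i + (\<Sum>j\<in>J. r j *\<^sub>R (bar j - U n i)) \<in> B"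
    using bar_in_B by (intro convex_relaxation[OF B(2) J Ui]) auto
  have sourced: "U n i + (2 * dt) *\<^sub>R S (U n i) \<in> B"
    using source[OF Ui] dt_pos source_cfl by simp

  define F where "F = (\<Sum>j\<in>J. f (U n j) *v c i j - f (U n i) *v c i j)"
  define D where "D = (\<Sum>j\<in>J. d j *\<^sub>R (U n j - U n i))"
  have flux: "(\<Sum>j\<in>I i. f (U n j) *v c i j) = F"
  proof -
    have "(\<Sum>j\<in>I i. f (U n i) *v c i j) = 0"
      using linear_sum[OF matrix_vector_mul_linear, of "f (U n i)" "c i" "I i"] c_sum[OF node]
      by simp
    then have "(\<Sum>j\<in>I i. f (U n j) *v c i j) = (\<Sum>j\<in>I i. f (U n j) *v c i j - f (U n i) *v c i j)"
      by (simp add: sum_subtractf)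
    then show ?thesis using I_eq J by (simp add: F_def)
  qed
  have "r j *\<^sub>R (bar j - U n i) = (2 * dt / m i) *\<^sub>R
      (d j *\<^sub>R (U n j - U n i) - (f (U n j) *v c i j - f (U n i) *v c i j))" if "j \<in> J" for j
    using d_pos[OF that] mass
    by (simp add: r_def bar_def vec_eq_iff field_simps)
  then have sum_bar: "(\<Sum>j\<in>J. r j *\<^sub>R (bar j - U n i)) = (2 * dt / m i) *\<^sub>R (D - F)"
    by (simp add: F_def D_def sum_subtractf flip: scaleR_sum_right)
  have "(m i / dt) *\<^sub>R (UL (Suc n) i - U n i) + F - D = m i *\<^sub>R S (U n i)"
    using scheme[OF node] flux by (simp add: low_order_update_def D_def d_def J_def)
  then have "(m i / dt) *\<^sub>R (UL (Suc n) i - U n i) = m i *\<^sub>R S (U n i) + (D - F)"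
    by (simp add: algebra_simps)
  from arg_cong[OF this, of "scaleR (dt / m i)"]
  have "UL (Suc n) i - U n i = dt *\<^sub>R S (U n i) + (dt / m i) *\<^sub>R (D - F)"
    using mass dt_pos by (simp add: scaleR_right_distrib del: scaleR_right_diff_distrib)
  then have "UL (Suc n) i = (1 / 2) *\<^sub>R (U n i + (2 * dt) *\<^sub>R S (U n i))
      + (1 / 2) *\<^sub>R (U n i + (\<Sum>j\<in>J. r j *\<^sub>R (bar j - U n i)))"
    unfolding sum_bar by (simp add: vec_eq_iff field_simps)
  also have "\<dots> \<in> B" by (rule convexD[OF B(2) sourced relaxed]) auto
  finally show ?thesis .
qed

end
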